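(* Let $E$ be a finite set and $f\colon 2^E\to\mathbb{R}_+$ a submodular, monotone, normalized function, let $X = B(f)$, and let $\mathcal{C}$ be the set of convex functions $c\colon X\to\mathbb{R}$. Let $\{E_1,\dots,E_k\}$ be the partition of $E$ into the connected components of the polymatroid $(E,f)$. Then for $S\subseteq E$ the following are equivalent: (i) $S$ is controlling for $(X,\mathcal{C})$; (ii) $S$ is identifying for $X$; (iii) $|S\cap E_i| \ge |E_i|-1$ for all $i\in\{1,\dots,k\}$.
   Context: $f$ is submodular if $f(S\cap T)+f(S\cup T)\le f(S)+f(T)$ for all $S,T\subseteq E$, monotone if $f(S)\le f(T)$ for $S\subseteq T$, normalized if $f(\emptyset)=0$. The base polyhedron is $B(f)=\{x\in\mathbb{R}_+^E : x(T)\le f(T)\ \forall T\subseteq E,\ x(E)=f(E)\}$, where $x(T)=\sum_{e\in T}x_e$. A polymatroid $(U,f)$ is connected if there is no non-empty proper subset $T\subsetneq U$ with $f(T)+f(U\setminus T)=f(U)$. The connected components are the unique partition $\{E_1,\dots,E_k\}$ of $E$ such that each $(E_i,f)$ (with $f$ restricted to subsets of $E_i$) is connected and $f(T)=\sum_{i}f(E_i\cap T)$ for all $T\subseteq E$. A set $S \subseteq E$ is controlling for $(X,\mathcal{C})$ if for every $c \in \mathcal{C}$ and every $x^* \in X$ there is $\gamma \in \mathbb{R}^S$ such that $\min_{x \in X}\{c(x) + \sum_{e\in S}\gamma_e x_e\}$ exists and is attained at $x^*$. A set $S$ is identifying for $X$ if for all $x\ne x'$ in $X$ there is $e\in S$ with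 $x_e\ne x'_e$.
   Formalization: The set of costs is restricted to convex functions on X that extend to a finite convex function on an open neighbourhood of X; for all convex c on X the claim fails, e.g. c(x) = -sqrt(x_1) on {x >= 0, x_1 + x_2 = 1} at x* = (0,1) with S = E. *)

theory Defs
  imports "HOL-Analysis.Analysis"
begin

definition submodular_on :: "'e set \<Rightarrow> ('e set \<Rightarrow> real) \<Rightarrow> bool" where
  "submodular_on E f \<longleftrightarrow>
     (\<forall>S T. S \<subseteq> E \<longrightarrow> T \<subseteq> E \<longrightarrow> f (S \<inter> T) + f (S \<union> T) \<le> f S + f T)"

definition polymatroid :: "'e set \<Rightarrow> ('e set \<Rightarrow> real) \<Rightarrow> bool" where
  "polymatroid E f \<longleftrightarrow>
     (\<forall>T\<subseteq>E. 0 \<le> f T) \<and> submodular_on E f \<and> mono_on (Pow E) f \<and> f {} = 0"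

text \<open>
  The ground set \<open>E\<close> is an arbitrary (possibly empty) subset of a finite index type, and
  \<open>\<real>\<^sup>E\<close> is the coordinate subspace of the vectors that vanish outside \<open>E\<close>.
\<close>

definition base_polyhedron :: "'e set \<Rightarrow> ('e set \<Rightarrow> real) \<Rightarrow> (real ^ 'e::finite) set" where
  "base_polyhedron E f =
     {x. (\<forall>e. e \<notin> E \<longrightarrow> x $ e = 0) \<and> (\<forall>e\<in>E. 0 \<le> x $ e) \<and>
         (\<forall>T\<subseteq>E. (\<Sum>e\<in>T. x $ e) \<le> f T) \<and> (\<Sum>e\<in>E. x $ e) = f E}"

definition polymatroid_connected :: "'e set \<Rightarrow> ('e set \<Rightarrow> real) \<Rightarrow> bool" where
  "polymatroid_connected U f \<longleftrightarrow> \<not> (\<exists>T. T \<noteq> {} \<and> T \<subset> U \<and> f T + f (U - T) = f U)"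

definition polymatroid_components ::
    "'e set \<Rightarrow> ('e set \<Rightarrow> real) \<Rightarrow> 'e set set \<Rightarrow> bool" where
  "polymatroid_components E f P \<longleftrightarrow>
     partition_on E P \<and> (\<forall>U\<in>P. polymatroid_connected U f) \<and>
     (\<forall>T\<subseteq>E. f T = (\<Sum>U\<in>P. f (U \<inter> T)))"

text \<open>
  The convex functions \<open>X \<rightarrow> \<real>\<close>, with the convention that they are finite and convex on
  an open neighbourhood of \<open>X\<close>, which guarantees subgradients at the boundary points of \<open>X\<close>.
  Without it no set is controlling as soon as \<open>X\<close> has two points: for
  \<open>X = {x \<ge> 0. x\<^sub>1 + x\<^sub>2 = 1}\<close> the function \<open>- sqrt x\<^sub>1\<close> is continuous and convex on \<open>X\<close>, but
  no linear perturbation of it has a minimum at \<open>(0, 1)\<close>.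
  Only the values of \<open>c\<close> on \<open>X\<close> matter.
\<close>

definition convex_costs :: "'v::real_normed_vector set \<Rightarrow> ('v \<Rightarrow> real) set" where
  "convex_costs X =
     {c. convex_on X c \<and>
         (\<exists>U g. open U \<and> X \<subseteq> U \<and> convex_on U g \<and> (\<forall>x\<in>X. g x = c x))}"

definition controlling ::
    "'e set \<Rightarrow> (real ^ 'e::finite) set \<Rightarrow> (real ^ 'e \<Rightarrow> real) set \<Rightarrow> bool" where
  "controlling S X C \<longleftrightarrow>
     (\<forall>c\<in>C. \<forall>z\<in>X. \<exists>\<gamma> :: 'e \<Rightarrow> real.
        is_arg_min (\<lambda>x. c x + (\<Sum>e\<in>S. \<gamma> e * x $ e)) (\<lambda>x. x \<in> X) z)"

definition identifying :: "'e set \<Rightarrow> (real ^ 'e::finite) set \<Rightarrow> bool" where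
  "identifying S X \<longleftrightarrow> (\<forall>x\<in>X. \<forall>y\<in>X. x \<noteq> y \<longrightarrow> (\<exists>e\<in>S. x $ e \<noteq> y $ e))"

end

theory Submission
  imports Defs
begin

text \<open>
  For every convex set \<open>X\<close>, controlling and identifying sets are the same. The linear cost
  \<open>v \<mapsto> (y - x) \<bullet> v\<close> shows that a controlling set tells \<open>x\<close> from \<open>y\<close>. Conversely, the multiples of
  differences of points of \<open>X\<close> form a subspace; if \<open>S\<close> is identifying, then the projection to the
  coordinates in \<open>S\<close> is injective there, so a subgradient of the cost can be cancelled by a linear
  function of these coordinates.

  For \<open>X = B(f)\<close>, call \<open>T\<close> a separator if \<open>f T + f (E - T) = f E\<close>. Separators are exactly the sets
  that are tight for all bases, and a generic base is tight on no other set. A component is a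
  separator, so a base is determined on it by all but one of its coordinates. A separator cannot
  split a component, so at a generic base some weight can be moved between any two elements of it.
\<close>

section \<open>Convex functions\<close>

lemma graph_point_notin_rel_interior_epigraph:
  fixes g :: "'a::euclidean_space \<Rightarrow> real"
  assumes "z \<in> U"
  shows "(z, g z) \<notin> rel_interior (epigraph U g)" (is "_ \<notin> rel_interior ?epi")
proof
  assume "(z, g z) \<in> rel_interior ?epi"
  then obtain r where "r > 0" and ball: "cball (z, g z) r \<inter> affine hull ?epi \<subseteq> ?epi"
    by (auto simp: mem_rel_interior_cball)
  have "(z, g z) \<in> ?epi" "(z, g z + 1) \<in> ?epi"
    using assms by (auto simp: mem_epigraph)
  then have "(1 + r) *\<^sub>R (z, g z) + (- r) *\<^sub>R (z, g z + 1) \<in> affine hull ?epi"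
    by (intro mem_affine[OF affine_affine_hull]) (auto intro: hull_inc)
  then have "(z, g z - r) \<in> affine hull ?epi"
    by (simp add: algebra_simps)
  moreover have "(z, g z - r) \<in> cball (z, g z) r"
    using \<open>r > 0\<close> by (simp add: dist_Pair_Pair dist_real_def)
  ultimately have "(z, g z - r) \<in> ?epi"
    using ball by blast
  then show False
    using \<open>r > 0\<close> by (simp add: mem_epigraph)
qed

lemma convex_on_epigraph_support:
  fixes g :: "'a::euclidean_space \<Rightarrow> real"
  assumes "convex_on U g" "z \<in> U"
  obtains p q where "(p, q) \<noteq> 0" "0 \<le> q" "\<And>x. x \<in> U \<Longrightarrow> p \<bullet> z + q * g z \<le> p \<bullet> x + q * g x"
proof -
  let ?epi = "epigraph U g"
  have above: "(z, g z) \<in> ?epi" "(z, g z + 1) \<in> ?epi"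
    using assms(2) by (auto simp: mem_epigraph)
  obtain a where "a \<noteq> 0" and support: "\<And>v. v \<in> ?epi \<Longrightarrow> a \<bullet> (z, g z) \<le> a \<bullet> v"
    using supporting_hyperplane_rel_boundary[OF convex_epigraphI[OF assms(1)] above(1)]
      graph_point_notin_rel_interior_epigraph[OF assms(2)] by metis
  obtain p q where a_eq: "a = (p, q)"
    by (cases a)
  show thesis
  proof (rule that)
    show "(p, q) \<noteq> 0"
      using \<open>a \<noteq> 0\<close> a_eq by simp
    show "0 \<le> q"
      using support[OF above(2)] by (simp add: a_eq distrib_left)
    show "p \<bullet> z + q * g z \<le> p \<bullet> x + q * g x" if "x \<in> U" for x
      using support[of "(x, g x)"] that by (simp add: a_eq mem_epigraph)
  qed
qed

lemma convex_on_open_subgradient: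
  fixes g :: "'a::euclidean_space \<Rightarrow> real"
  assumes "convex_on U g" "open U" "z \<in> U"
  obtains h where "\<And>x. x \<in> U \<Longrightarrow> g z + h \<bullet> (x - z) \<le> g x"
proof -
  obtain p q where "(p, q) \<noteq> 0" "0 \<le> q"
      and support: "\<And>x. x \<in> U \<Longrightarrow> p \<bullet> z + q * g z \<le> p \<bullet> x + q * g x"
    using convex_on_epigraph_support[OF assms(1,3)] by blast
  have "q \<noteq> 0"
  proof
    assume "q = 0"
    have "((\<lambda>v. p \<bullet> v) has_derivative (\<lambda>v. p \<bullet> v)) (at z)"
      by (intro has_derivative_inner_right has_derivative_ident)
    then have "(\<lambda>v. p \<bullet> v) = (\<lambda>v. 0)"
      using support \<open>q = 0\<close> by (intro differential_zero_maxmin[OF assms(3,2)]) auto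
    then have "p = 0"
      by (metis inner_eq_zero_iff)
    then show False
      using \<open>(p, q) \<noteq> 0\<close> \<open>q = 0\<close> by (simp add: zero_prod_def)
  qed
  show thesis
  proof (rule that)
    show "g z + (- p /\<^sub>R q) \<bullet> (x - z) \<le> g x" if "x \<in> U" for x
      using support[OF that] \<open>0 \<le> q\<close> \<open>q \<noteq> 0\<close> by (simp add: field_simps inner_diff_right)
  qed
qed

lemma convex_on_common_strict_point:
  fixes g :: "'i \<Rightarrow> 'v::real_vector \<Rightarrow> real"
  assumes "finite I" "convex X" "X \<noteq> {}" "\<And>i. i \<in> I \<Longrightarrow> convex_on X (g i)"
    and "\<And>i x. i \<in> I \<Longrightarrow> x \<in> X \<Longrightarrow> g i x \<le> b i"
    and "\<And>i. i \<in> I \<Longrightarrow> \<exists>x\<in>X. g i x < b i"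
  shows "\<exists>x\<in>X. \<forall>i\<in>I. g i x < b i"
  using assms(1,4-6)
proof (induction I rule: finite_induct)
  case empty
  then show ?case using assms(3) by auto
next
  case (insert j I)
  obtain x where x_strict: "x \<in> X" "\<forall>i\<in>I. g i x < b i"
    using insert by (metis insertI2)
  obtain y where y_strict: "y \<in> X" "g j y < b j"
    using insert.prems(3) by blast
  let ?mid = "(1 / 2) *\<^sub>R x + (1 / 2) *\<^sub>R y"
  have "?mid \<in> X"
    using assms(2) x_strict y_strict by (intro convexD) auto
  moreover have "g i ?mid < b i" if "i \<in> insert j I" for i
  proof -
    have "g i ?mid \<le> (g i x + g i y) / 2"
      using convex_onD[OF insert.prems(1)[OF that], of "1 / 2" x y] x_strict(1) y_strict(1) by simp
    moreover have "g i x + g i y < 2 * b i"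
      using insert.prems(2)[OF that x_strict(1)] insert.prems(2)[OF that y_strict(1)]
        x_strict(2) y_strict(2) that by force
    ultimately show ?thesis by simp
  qed
  ultimately show ?case by blast
qed

section \<open>Controlling and identifying sets of a convex set\<close>

lemma subspace_conic_hull_differences:
  assumes "convex X" "X \<noteq> {}"
  shows "subspace (conic hull (\<Union>x\<in>X. \<Union>y\<in>X. {x - y}))" (is "subspace (conic hull ?D)")
  unfolding subspace_convex_cone_symmetric
proof
  show "convex_cone (conic hull ?D)"
    using assms convex_conic_hull[OF convex_differences[OF assms(1) assms(1)]]
    by (auto simp: convex_cone_def conic_conic_hull conic_hull_eq_empty)
  have "- v \<in> ?D" if "v \<in> ?D" for v
    using that by force
  then show "\<forall>v\<in>conic hull ?D. - v \<in> conic hull ?D"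
    unfolding conic_hull_explicit by (force simp flip: scaleR_minus_right)
qed

lemma inner_factors_through_inj_on:
  fixes p :: "'a::euclidean_space \<Rightarrow> 'b::euclidean_space"
  assumes "subspace V" "linear p" "inj_on p V"
  obtains k where "\<And>v. v \<in> V \<Longrightarrow> h \<bullet> v = k \<bullet> p v"
proof -
  obtain r where "linear r" "\<forall>v\<in>V. r (p v) = v"
    using linear_exists_left_inverse_on[OF assms(2,1,3)] by blast
  then have "h \<bullet> v = adjoint r h \<bullet> p v" if "v \<in> V" for v
    using that by (simp add: adjoint_works inner_commute)
  then show thesis
    by (rule that)
qed

definition restrict_coords :: "'e set \<Rightarrow> real ^ 'e \<Rightarrow> real ^ 'e::finite" where
  "restrict_coords S v = (\<chi> e. if e \<in> S then v $ e else 0)"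

lemma linear_restrict_coords: "linear (restrict_coords S)"
  by (rule linearI) (auto simp: restrict_coords_def vec_eq_iff)

lemma inner_restrict_coords: "k \<bullet> restrict_coords S v = (\<Sum>e\<in>S. k $ e * v $ e)"
  by (simp add: inner_vec_def restrict_coords_def if_distrib sum.If_cases cong: if_cong)

lemma identifying_imp_inj_on_restrict_coords:
  fixes X :: "(real ^ 'e::finite) set"
  assumes "convex X" "X \<noteq> {}" "identifying S X"
  shows "inj_on (restrict_coords S) (conic hull (\<Union>x\<in>X. \<Union>y\<in>X. {x - y}))"
  unfolding linear_inj_on_iff_eq_0[OF linear_restrict_coords
      subspace_conic_hull_differences[OF assms(1,2)]]
proof (intro ballI impI)
  fix v
  assume "v \<in> conic hull (\<Union>x\<in>X. \<Union>y\<in>X. {x - y})" and restrict: "restrict_coords S v = 0"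
  then obtain a x y where xy: "x \<in> X" "y \<in> X" and v_eq: "v = a *\<^sub>R (x - y)"
    unfolding conic_hull_explicit by blast
  have "a = 0 \<or> x $ e = y $ e" if "e \<in> S" for e
  proof -
    have "restrict_coords S v $ e = 0"
      using restrict by simp
    then show ?thesis
      using that by (simp add: restrict_coords_def v_eq)
  qed
  then have "a = 0 \<or> x = y"
    using assms(3) xy unfolding identifying_def by blast
  then show "v = 0"
    using v_eq by auto
qed

lemma identifying_inner_diff_eq_sum:
  fixes X :: "(real ^ 'e::finite) set"
  assumes "convex X" "identifying S X"
  obtains k :: "real ^ 'e"
    where "\<And>x y. x \<in> X \<Longrightarrow> y \<in> X \<Longrightarrow> h \<bullet> (x - y) = (\<Sum>e\<in>S. k $ e * (x $ e - y $ e))"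
proof (cases "X = {}")
  case False
  let ?V = "conic hull (\<Union>x\<in>X. \<Union>y\<in>X. {x - y})"
  obtain k where "\<And>v. v \<in> ?V \<Longrightarrow> h \<bullet> v = k \<bullet> restrict_coords S v"
    using inner_factors_through_inj_on[OF subspace_conic_hull_differences linear_restrict_coords
        identifying_imp_inj_on_restrict_coords] assms False by metis
  moreover have "x - y \<in> ?V" if "x \<in> X" "y \<in> X" for x y
    using that by (intro hull_inc) blast
  ultimately show thesis
    by (intro that[of k]) (simp add: inner_restrict_coords)
qed (use that in blast)

lemma identifying_imp_controlling:
  assumes "convex X" "identifying S X"
  shows "controlling S X (convex_costs X)"
  unfolding controlling_def
proof (intro ballI)
  fix c z
  assume "c \<in> convex_costs X" and "z \<in> X"
  then obtain U g where "open U" "X \<subseteq> U" "convex_on U g" and g_eq: "\<And>x. x \<in> X \<Longrightarrow> g x = c x"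
    by (auto simp: convex_costs_def)
  then obtain h where "\<And>x. x \<in> U \<Longrightarrow> g z + h \<bullet> (x - z) \<le> g x"
    using convex_on_open_subgradient \<open>z \<in> X\<close> by blast
  then have subgradient: "c z + h \<bullet> (x - z) \<le> c x" if "x \<in> X" for x
    using g_eq \<open>X \<subseteq> U\<close> \<open>z \<in> X\<close> that by (metis subsetD)
  obtain k where h_eq: "\<And>x. x \<in> X \<Longrightarrow> h \<bullet> (x - z) = (\<Sum>e\<in>S. k $ e * (x $ e - z $ e))"
    using identifying_inner_diff_eq_sum[OF assms] \<open>z \<in> X\<close> by metis
  have "c z + (\<Sum>e\<in>S. - k $ e * z $ e) \<le> c x + (\<Sum>e\<in>S. - k $ e * x $ e)" if "x \<in> X" for x
    using subgradient[OF that] unfolding h_eq[OF that]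
    by (simp add: right_diff_distrib sum_subtractf sum_negf)
  then show "\<exists>\<gamma>. is_arg_min (\<lambda>x. c x + (\<Sum>e\<in>S. \<gamma> e * x $ e)) (\<lambda>x. x \<in> X) z"
    using \<open>z \<in> X\<close> by (intro exI[of _ "\<lambda>e. - k $ e"]) (simp add: is_arg_min_linorder)
qed

lemma inner_in_convex_costs:
  fixes a :: "'v::real_inner"
  assumes "convex X"
  shows "(\<lambda>v. a \<bullet> v) \<in> convex_costs X"
proof -
  have "convex_on A (\<lambda>v. a \<bullet> v)" if "convex A" for A
    using that by (auto simp: convex_on_def inner_add_right)
  then show ?thesis
    unfolding convex_costs_def using assms by (blast intro: open_UNIV convex_UNIV)
qed

lemma controlling_imp_identifying:
  assumes "convex X" "controlling S X (convex_costs X)"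
  shows "identifying S X"
  unfolding identifying_def
proof (intro ballI impI, rule ccontr)
  fix x y
  assume "x \<in> X" and "y \<in> X" and "x \<noteq> y" and agree: "\<not> (\<exists>e\<in>S. x $ e \<noteq> y $ e)"
  obtain \<gamma> where
    "is_arg_min (\<lambda>v. (y - x) \<bullet> v + (\<Sum>e\<in>S. \<gamma> e * v $ e)) (\<lambda>v. v \<in> X) y"
    using assms(2) \<open>y \<in> X\<close> inner_in_convex_costs[OF assms(1)] unfolding controlling_def by blast
  moreover have "(\<Sum>e\<in>S. \<gamma> e * x $ e) = (\<Sum>e\<in>S. \<gamma> e * y $ e)"
    using agree by (intro sum.cong) auto
  ultimately have "(y - x) \<bullet> (y - x) \<le> 0"
    using \<open>x \<in> X\<close> by (auto simp: is_arg_min_linorder inner_diff_right)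
  then show False
    using \<open>x \<noteq> y\<close> by (metis inner_gt_zero_iff not_le right_minus_eq)
qed

lemma controlling_iff_identifying:
  assumes "convex X"
  shows "controlling S X (convex_costs X) \<longleftrightarrow> identifying S X"
  using controlling_imp_identifying[OF assms] identifying_imp_controlling[OF assms] by blast

section \<open>Polymatroids and their bases\<close>

lemma polymatroid_empty: "polymatroid E f \<Longrightarrow> f {} = 0"
  by (simp add: polymatroid_def)

lemma polymatroid_subset: "polymatroid E f \<Longrightarrow> A \<subseteq> E \<Longrightarrow> polymatroid A f"
  unfolding polymatroid_def submodular_on_def by (auto intro: mono_on_subset)

lemma polymatroid_mono: "polymatroid E f \<Longrightarrow> A \<subseteq> B \<Longrightarrow> B \<subseteq> E \<Longrightarrow> f A \<le> f B"
  unfolding polymatroid_def by (auto intro: mono_onD)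

lemma polymatroid_submodular:
  "polymatroid E f \<Longrightarrow> A \<subseteq> E \<Longrightarrow> B \<subseteq> E \<Longrightarrow> f (A \<inter> B) + f (A \<union> B) \<le> f A + f B"
  unfolding polymatroid_def submodular_on_def by blast

definition tight :: "('e set \<Rightarrow> real) \<Rightarrow> real ^ 'e::finite \<Rightarrow> 'e set \<Rightarrow> bool" where
  "tight f x T \<longleftrightarrow> (\<Sum>e\<in>T. x $ e) = f T"

lemma base_polyhedron_outside: "x \<in> base_polyhedron E f \<Longrightarrow> e \<notin> E \<Longrightarrow> x $ e = 0"
  by (simp add: base_polyhedron_def)

lemma base_polyhedron_le: "x \<in> base_polyhedron E f \<Longrightarrow> T \<subseteq> E \<Longrightarrow> (\<Sum>e\<in>T. x $ e) \<le> f T"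
  by (simp add: base_polyhedron_def)

lemma base_polyhedron_tight: "x \<in> base_polyhedron E f \<Longrightarrow> tight f x E"
  by (simp add: base_polyhedron_def tight_def)

text \<open>Nonnegativity comes for free: \<open>x e = f E - x (E - {e}) \<ge> f E - f (E - {e}) \<ge> 0\<close>.\<close>

lemma base_polyhedronI:
  assumes "polymatroid E f" "\<And>e. e \<notin> E \<Longrightarrow> x $ e = 0"
    and "\<And>T. T \<subseteq> E \<Longrightarrow> (\<Sum>e\<in>T. x $ e) \<le> f T" "tight f x E"
  shows "x \<in> base_polyhedron E f"
proof -
  have "0 \<le> x $ e" if "e \<in> E" for e
  proof -
    have "(\<Sum>e\<in>E. x $ e) = x $ e + (\<Sum>e\<in>E - {e}. x $ e)"
      using that by (simp add: sum.remove)
    moreover have "(\<Sum>e\<in>E - {e}. x $ e) \<le> f (E - {e})" "f (E - {e}) \<le> f E"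
      using assms(3) polymatroid_mono[OF assms(1)] by auto
    ultimately show ?thesis
      using assms(4) by (simp add: tight_def)
  qed
  then show ?thesis
    using assms by (simp add: base_polyhedron_def tight_def)
qed

lemma convex_base_polyhedron: "convex (base_polyhedron E f)"
proof (rule convexI)
  fix x y :: "real ^ 'a" and u v :: real
  assume x_base: "x \<in> base_polyhedron E f" and y_base: "y \<in> base_polyhedron E f"
    and weights: "0 \<le> u" "0 \<le> v" "u + v = 1"
  have sum_combination:
    "(\<Sum>e\<in>T. (u *\<^sub>R x + v *\<^sub>R y) $ e) = u * (\<Sum>e\<in>T. x $ e) + v * (\<Sum>e\<in>T. y $ e)" for T
    by (simp add: sum.distrib sum_distrib_left)
  have "u * (\<Sum>e\<in>T. x $ e) + v * (\<Sum>e\<in>T. y $ e) \<le> f T" if "T \<subseteq> E" for T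
    using base_polyhedron_le[OF x_base that] base_polyhedron_le[OF y_base that] weights
    by (rule convex_bound_le)
  then show "u *\<^sub>R x + v *\<^sub>R y \<in> base_polyhedron E f"
    unfolding base_polyhedron_def mem_Collect_eq sum_combination
    using x_base y_base weights by (auto simp: base_polyhedron_def simp flip: distrib_right)
qed

lemma base_polyhedron_insert:
  assumes "polymatroid (insert a A) f" "a \<notin> A" "x \<in> base_polyhedron A f"
  shows "x + axis a (f (insert a A) - f A) \<in> base_polyhedron (insert a A) f" (is "?y \<in> _")
proof (rule base_polyhedronI[OF assms(1)])
  let ?\<delta> = "f (insert a A) - f A"
  have sum_y: "(\<Sum>e\<in>T. ?y $ e) = (\<Sum>e\<in>T - {a}. x $ e) + (if a \<in> T then ?\<delta> else 0)" for T
  proof -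
    have "(\<Sum>e\<in>T. x $ e) = (\<Sum>e\<in>T - {a}. x $ e)"
      using base_polyhedron_outside[OF assms(3,2)] by (intro sum.mono_neutral_right) auto
    then show ?thesis
      by (simp add: sum.distrib axis_def)
  qed
  show "?y $ e = 0" if "e \<notin> insert a A" for e
    using that base_polyhedron_outside[OF assms(3)] by (auto simp: axis_def)
  show "tight f ?y (insert a A)"
    using base_polyhedron_tight[OF assms(3)] assms(2) unfolding tight_def sum_y by simp
  show "(\<Sum>e\<in>T. ?y $ e) \<le> f T" if "T \<subseteq> insert a A" for T
  proof -
    have x_le: "(\<Sum>e\<in>T - {a}. x $ e) \<le> f (T - {a})"
      using \<open>T \<subseteq> insert a A\<close> by (intro base_polyhedron_le[OF assms(3)]) auto
    show ?thesis
    proof (cases "a \<in> T")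
      case True
      then have "T \<inter> A = T - {a}" "T \<union> A = insert a A"
        using \<open>T \<subseteq> insert a A\<close> assms(2) by auto
      then have "f (T - {a}) + f (insert a A) \<le> f T + f A"
        using polymatroid_submodular[OF assms(1) \<open>T \<subseteq> insert a A\<close>, of A] by auto
      then show ?thesis
        using True x_le unfolding sum_y by simp
    next
      case False
      then show ?thesis
        using x_le unfolding sum_y by simp
    qed
  qed
qed

lemma base_polyhedron_extend:
  fixes x :: "real ^ 'e::finite"
  assumes "polymatroid (A \<union> D) f" "A \<inter> D = {}" "x \<in> base_polyhedron A f"
  obtains y where "y \<in> base_polyhedron (A \<union> D) f" "\<And>e. e \<in> A \<Longrightarrow> y $ e = x $ e"
  using finite[of D] assms
proof (induction D arbitrary: thesis rule: finite_induct)
  case empty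
  then show ?case by simp
next
  case (insert d D)
  have "polymatroid (A \<union> D) f"
    using insert.prems(2) by (rule polymatroid_subset) auto
  then obtain y where y_base: "y \<in> base_polyhedron (A \<union> D) f"
      and y_eq: "\<And>e. e \<in> A \<Longrightarrow> y $ e = x $ e"
    using insert.IH insert.prems(3,4) by auto
  let ?y' = "y + axis d (f (insert d (A \<union> D)) - f (A \<union> D))"
  show ?case
  proof (rule insert.prems(1))
    show "?y' \<in> base_polyhedron (A \<union> insert d D) f"
      using base_polyhedron_insert[OF _ _ y_base, of d] insert.prems(2,3) insert.hyps by simp
    show "?y' $ e = x $ e" if "e \<in> A" for e
      using that insert.prems(3) y_eq by (auto simp: axis_def)
  qed
qed

lemma exists_base_tight_on:
  fixes E A :: "'e::finite set"
  assumes "polymatroid E f" "A \<subseteq> E"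
  obtains x where "x \<in> base_polyhedron E f" "tight f x A"
proof -
  have "0 \<in> base_polyhedron {} f"
    using polymatroid_empty[OF assms(1)] by (auto simp: base_polyhedron_def)
  then obtain x where x_base: "x \<in> base_polyhedron A f"
    using base_polyhedron_extend[of "{}" A f 0] polymatroid_subset[OF assms] by auto
  have "A \<union> (E - A) = E"
    using assms(2) by auto
  then obtain y where y_base: "y \<in> base_polyhedron E f" and "\<And>e. e \<in> A \<Longrightarrow> y $ e = x $ e"
    using base_polyhedron_extend[OF _ _ x_base, of "E - A"] assms(1) by auto
  then have "tight f y A"
    using base_polyhedron_tight[OF x_base] by (simp add: tight_def)
  with y_base show thesis
    by (rule that)
qed

section \<open>Separators\<close>

definition separator :: "'e set \<Rightarrow> ('e set \<Rightarrow> real) \<Rightarrow> 'e set \<Rightarrow> bool" where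
  "separator E f T \<longleftrightarrow> T \<subseteq> E \<and> f T + f (E - T) = f E"

lemma separator_Int:
  assumes "polymatroid E f" "separator E f T" "U \<subseteq> E"
  shows "separator U f (U \<inter> T)"
proof -
  have "T \<subseteq> E" and additive: "f T + f (E - T) = f E"
    using assms(2) by (auto simp: separator_def)
  have sets: "(U \<union> T) \<inter> (E - T) = U - T" "(U \<union> T) \<union> (E - T) = E"
      "(U \<inter> T) \<inter> (U - T) = {}" "(U \<inter> T) \<union> (U - T) = U" "U - U \<inter> T = U - T"
    using assms(3) \<open>T \<subseteq> E\<close> by auto
  have "f U \<le> f (U \<inter> T) + f (U - T)"
    using polymatroid_submodular[OF assms(1), of "U \<inter> T" "U - T"] assms(3)
      polymatroid_empty[OF assms(1)] unfolding sets by auto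
  moreover have "f (U \<inter> T) + f (U \<union> T) \<le> f U + f T"
    using assms(3) \<open>T \<subseteq> E\<close> by (rule polymatroid_submodular[OF assms(1)])
  moreover have "f (U - T) + f E \<le> f (U \<union> T) + f (E - T)"
    using polymatroid_submodular[OF assms(1), of "U \<union> T" "E - T"] assms(3) \<open>T \<subseteq> E\<close>
    unfolding sets by auto
  ultimately show ?thesis
    using additive by (simp add: separator_def sets)
qed

lemma polymatroid_connected_separator_cases:
  assumes "polymatroid E f" "separator E f T" "U \<subseteq> E" "polymatroid_connected U f"
  shows "U \<inter> T = {} \<or> U \<subseteq> T"
proof -
  have "f (U \<inter> T) + f (U - U \<inter> T) = f U"
    using separator_Int[OF assms(1-3)] by (simp add: separator_def)
  then have "U \<inter> T = {} \<or> \<not> U \<inter> T \<subset> U"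
    using assms(4) unfolding polymatroid_connected_def by metis
  then show ?thesis
    by blast
qed

lemma separator_tight:
  fixes E :: "'e::finite set"
  assumes "separator E f T" "x \<in> base_polyhedron E f"
  shows "tight f x T"
proof -
  have T_subset: "T \<subseteq> E" and additive: "f T + f (E - T) = f E"
    using assms(1) by (auto simp: separator_def)
  have "(\<Sum>e\<in>E - T. x $ e) + (\<Sum>e\<in>T. x $ e) = f E"
    using base_polyhedron_tight[OF assms(2)] sum.subset_diff[OF T_subset finite, of "($) x"]
    by (simp add: tight_def)
  then show ?thesis
    using base_polyhedron_le[OF assms(2) T_subset] base_polyhedron_le[OF assms(2), of "E - T"]
      additive by (simp add: tight_def)
qed

lemma not_separator_exists_base_less:
  fixes E :: "'e::finite set"
  assumes "polymatroid E f" "T \<subseteq> E" "\<not> separator E f T"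
  obtains x where "x \<in> base_polyhedron E f" "(\<Sum>e\<in>T. x $ e) < f T"
proof -
  obtain x where x_base: "x \<in> base_polyhedron E f" and "tight f x (E - T)"
    using exists_base_tight_on[OF assms(1), of "E - T"] by auto
  have "(\<Sum>e\<in>T. x $ e) = f E - f (E - T)"
    using base_polyhedron_tight[OF x_base] \<open>tight f x (E - T)\<close>
      sum.subset_diff[OF assms(2) finite, of "($) x"] by (simp add: tight_def)
  then have "(\<Sum>e\<in>T. x $ e) \<noteq> f T"
    using assms(2,3) by (auto simp: separator_def)
  then show thesis
    using that[OF x_base] base_polyhedron_le[OF x_base assms(2)] by simp
qed

lemma exists_base_tight_only_on_separators:
  fixes E :: "'e::finite set"
  assumes "polymatroid E f"
  obtains x where "x \<in> base_polyhedron E f" "\<And>T. T \<subseteq> E \<Longrightarrow> tight f x T \<Longrightarrow> separator E f T"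
proof -
  let ?X = "base_polyhedron E f" and ?I = "{T. T \<subseteq> E \<and> \<not> separator E f T}"
  have "\<exists>x\<in>?X. \<forall>T\<in>?I. (\<Sum>e\<in>T. x $ e) < f T"
  proof (rule convex_on_common_strict_point)
    show "convex ?X"
      by (rule convex_base_polyhedron)
    show "?X \<noteq> {}"
      using exists_base_tight_on[OF assms, of "{}"] by auto
    show "convex_on ?X (\<lambda>x. \<Sum>e\<in>T. x $ e)" for T
      by (simp add: convex_on_def convex_base_polyhedron sum.distrib sum_distrib_left)
    show "(\<Sum>e\<in>T. x $ e) \<le> f T" if "T \<in> ?I" "x \<in> ?X" for T x
      using that by (simp add: base_polyhedron_le)
    show "\<exists>x\<in>?X. (\<Sum>e\<in>T. x $ e) < f T" if "T \<in> ?I" for T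
      using that not_separator_exists_base_less[OF assms] by blast
  qed simp
  then obtain x where "x \<in> ?X" and strict: "\<And>T. T \<in> ?I \<Longrightarrow> (\<Sum>e\<in>T. x $ e) < f T"
    by blast
  have "separator E f T" if "T \<subseteq> E" "tight f x T" for T
    using strict[of T] that by (auto simp: tight_def)
  with \<open>x \<in> ?X\<close> show thesis
    by (rule that)
qed

section \<open>Exchanges in a base\<close>

lemma base_polyhedron_exchange:
  fixes E :: "'e::finite set"
  assumes "polymatroid E f" "x \<in> base_polyhedron E f" "e \<in> E" "d \<in> E"
    and not_tight: "\<And>T. T \<subseteq> E \<Longrightarrow> e \<in> T \<Longrightarrow> d \<notin> T \<Longrightarrow> \<not> tight f x T"
  obtains \<epsilon> where "\<epsilon> > 0" "x + axis e \<epsilon> - axis d \<epsilon> \<in> base_polyhedron E f"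
proof -
  let ?F = "{T. T \<subseteq> E \<and> e \<in> T \<and> d \<notin> T}"
  have "\<forall>\<^sub>F \<epsilon> in at_right 0. \<epsilon> \<in> {0<..<f T - (\<Sum>a\<in>T. x $ a)}" if "T \<in> ?F" for T
    using that base_polyhedron_le[OF assms(2), of T] not_tight[of T]
    by (intro eventually_at_right_real) (auto simp: tight_def)
  then have "\<forall>\<^sub>F \<epsilon> in at_right 0. 0 < \<epsilon> \<and> (\<forall>T\<in>?F. \<epsilon> \<in> {0<..<f T - (\<Sum>a\<in>T. x $ a)})"
    by (intro eventually_conj eventually_at_right_less eventually_ball_finite) auto
  then obtain \<epsilon> where "0 < \<epsilon>" and slack: "\<And>T. T \<in> ?F \<Longrightarrow> \<epsilon> \<in> {0<..<f T - (\<Sum>a\<in>T. x $ a)}"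
    using eventually_happens'[OF trivial_limit_at_right_real] by blast
  let ?y = "x + axis e \<epsilon> - axis d \<epsilon>"
  have sum_y: "(\<Sum>a\<in>T. ?y $ a) =
      (\<Sum>a\<in>T. x $ a) + (if e \<in> T then \<epsilon> else 0) - (if d \<in> T then \<epsilon> else 0)" for T
    by (simp add: sum.distrib sum_subtractf axis_def)
  have "?y \<in> base_polyhedron E f"
  proof (rule base_polyhedronI[OF assms(1)])
    show "?y $ a = 0" if "a \<notin> E" for a
      using that base_polyhedron_outside[OF assms(2)] assms(3,4) by (auto simp: axis_def)
    show "tight f ?y E"
      using base_polyhedron_tight[OF assms(2)] assms(3,4) unfolding tight_def sum_y by simp
    show "(\<Sum>a\<in>T. ?y $ a) \<le> f T" if "T \<subseteq> E" for T
    proof (cases "T \<in> ?F")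
      case True
      then show ?thesis
        using slack[OF True] unfolding sum_y by simp
    next
      case False
      then show ?thesis
        using base_polyhedron_le[OF assms(2) that] that \<open>0 < \<epsilon>\<close> unfolding sum_y by auto
    qed
  qed
  then show thesis
    using \<open>0 < \<epsilon>\<close> that by blast
qed

section \<open>Identifying sets of the base polyhedron\<close>

lemma polymatroid_components_subset: "polymatroid_components E f P \<Longrightarrow> U \<in> P \<Longrightarrow> U \<subseteq> E"
  by (auto simp: polymatroid_components_def dest: partition_onD1)

lemma polymatroid_component_separator:
  fixes E :: "'e::finite set"
  assumes "polymatroid E f" "polymatroid_components E f P" "U \<in> P"
  shows "separator E f U"
proof -
  have "disjoint P" and additive: "\<And>T. T \<subseteq> E \<Longrightarrow> f T = (\<Sum>W\<in>P. f (W \<inter> T))"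
    using assms(2) by (auto simp: polymatroid_components_def partition_on_def)
  note component_subset = polymatroid_components_subset[OF assms(2)]
  have "W \<inter> (E - U) = W \<inter> E" if "W \<in> P - {U}" for W
    using disjointD[OF \<open>disjoint P\<close>] assms(3) that by blast
  moreover have "U \<inter> (E - U) = {}" "U \<inter> E = U"
    using component_subset[OF assms(3)] by auto
  ultimately have "f U + f (E - U) = f E"
    using additive[of E] additive[of "E - U"] assms(3) polymatroid_empty[OF assms(1)]
    by (simp add: sum.remove[of P U])
  then show ?thesis
    using component_subset[OF assms(3)] by (simp add: separator_def)
qed

lemma identifying_base_polyhedron_imp_card:
  fixes E S :: "'e::finite set"
  assumes "polymatroid E f" "polymatroid_components E f P"
    and "identifying S (base_polyhedron E f)" "U \<in> P"
  shows "card (U - S) \<le> 1"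
proof (rule ccontr)
  assume "\<not> card (U - S) \<le> 1"
  then obtain e d where unseen: "e \<in> U - S" "d \<in> U - S" "e \<noteq> d"
    by (auto simp: card_le_Suc0_iff_eq)
  have U_subset: "U \<subseteq> E" and U_connected: "polymatroid_connected U f"
    using polymatroid_components_subset[OF assms(2,4)] assms(2,4)
    by (auto simp: polymatroid_components_def)
  obtain x where x_base: "x \<in> base_polyhedron E f"
      and tight_imp_separator: "\<And>T. T \<subseteq> E \<Longrightarrow> tight f x T \<Longrightarrow> separator E f T"
    using exists_base_tight_only_on_separators[OF assms(1)] by blast
  have "\<not> tight f x T" if "T \<subseteq> E" "e \<in> T" "d \<notin> T" for T
    using polymatroid_connected_separator_cases[OF assms(1) tight_imp_separator U_subset
        U_connected, of T] that unseen by blast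
  then obtain \<epsilon> where "\<epsilon> > 0"
      and y_base: "x + axis e \<epsilon> - axis d \<epsilon> \<in> base_polyhedron E f" (is "?y \<in> _")
    using base_polyhedron_exchange[OF assms(1) x_base, of e d] U_subset unseen by blast
  have "?y $ e \<noteq> x $ e"
    using unseen(3) \<open>\<epsilon> > 0\<close> by (simp add: axis_def)
  then obtain a where "a \<in> S" "?y $ a \<noteq> x $ a"
    using assms(3) x_base y_base unfolding identifying_def by metis
  then show False
    using unseen by (auto simp: axis_def split: if_splits)
qed

lemma card_imp_identifying_base_polyhedron:
  fixes E S :: "'e::finite set"
  assumes "polymatroid E f" "polymatroid_components E f P"
    and card: "\<And>U. U \<in> P \<Longrightarrow> card (U - S) \<le> 1"
  shows "identifying S (base_polyhedron E f)"
  unfolding identifying_def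
proof (intro ballI impI, rule ccontr)
  fix x y
  assume x_base: "x \<in> base_polyhedron E f" and y_base: "y \<in> base_polyhedron E f" and "x \<noteq> y"
    and agree: "\<not> (\<exists>e\<in>S. x $ e \<noteq> y $ e)"
  then obtain e where e_differs: "x $ e \<noteq> y $ e"
    by (auto simp: vec_eq_iff)
  then have "e \<in> E"
    using base_polyhedron_outside[OF x_base] base_polyhedron_outside[OF y_base] by metis
  then obtain U where "U \<in> P" "e \<in> U"
    using assms(2) by (auto simp: polymatroid_components_def dest: partition_onD1)
  have "U - {e} \<subseteq> S"
    using card[OF \<open>U \<in> P\<close>] \<open>e \<in> U\<close> agree e_differs by (auto simp: card_le_Suc0_iff_eq)
  then have "(\<Sum>a\<in>U - {e}. x $ a) = (\<Sum>a\<in>U - {e}. y $ a)"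
    using agree by (intro sum.cong) auto
  moreover have "(\<Sum>a\<in>U. x $ a) = (\<Sum>a\<in>U. y $ a)"
    using separator_tight[OF polymatroid_component_separator[OF assms(1,2) \<open>U \<in> P\<close>]] x_base y_base
    by (simp add: tight_def)
  ultimately show False
    using e_differs \<open>e \<in> U\<close> by (simp add: sum.remove[of U e])
qed

theorem theorem5p1:
  fixes E S :: "'e::finite set" and f :: "'e set \<Rightarrow> real"
    and X :: "(real ^ 'e) set" and P :: "'e set set"
  assumes "polymatroid E f"
    and "X = base_polyhedron E f"
    and "polymatroid_components E f P"
    and "S \<subseteq> E"
  shows "(controlling S X (convex_costs X) \<longleftrightarrow> identifying S X) \<and>
         (identifying S X \<longleftrightarrow> (\<forall>U\<in>P. card (S \<inter> U) \<ge> card U - 1))"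
proof
  show "controlling S X (convex_costs X) \<longleftrightarrow> identifying S X"
    unfolding assms(2) by (rule controlling_iff_identifying[OF convex_base_polyhedron])
  have "identifying S X \<longleftrightarrow> (\<forall>U\<in>P. card (U - S) \<le> 1)"
    unfolding assms(2)
    using identifying_base_polyhedron_imp_card[OF assms(1,3)]
      card_imp_identifying_base_polyhedron[OF assms(1,3)] by blast
  moreover have "card (U - S) \<le> 1 \<longleftrightarrow> card U - 1 \<le> card (S \<inter> U)" for U
    using card_Int_Diff[of U S] by (auto simp: Int_commute)
  ultimately show "identifying S X \<longleftrightarrow> (\<forall>U\<in>P. card (S \<inter> U) \<ge> card U - 1)"
    by simp
qed

end
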